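(* Let $d\ge 1$ and $n\ge 1$ be integers. Let $A$ be an $[n]^{d+1}$ array of zeros and ones, and for $(i_1,\dots,i_d)\in[n]^d$ let $r_{i_1,\dots,i_d}$ be the number of ones in the line $A(i_1,\dots,i_d,\ast)$, i.e. the number of $t\in[n]$ with $A(i_1,\dots,i_d,t)=1$; assume every $r_{i_1,\dots,i_d}\ge 1$. Then $$Per_d(A)\le \prod_{(i_1,\dots,i_d)\in[n]^d} e^{f(d,\,r_{i_1,\dots,i_d})},$$ where $f$ is defined recursively, for integers $d\ge 0$ and $r\ge 1$, by $f(0,r)=\log r$ (natural logarithm) and $f(d,r)=\frac1r\sum_{k=1}^r f(d-1,k)$ for $d\ge 1$.
   Context: Write $[n]=\{1,\dots,n\}$. A line of an $[n]^{m}$ array $P$ is a vector of the form $\big(P(i_1,\dots,i_{j-1},t,i_{j+1},\dots,i_m)\big)_{t=1}^n$, where $1\le j\le m$ and the other indices are fixed elements of $[n]$. A $d$-dimensional permutation of order $n$ is an $[n]^{d+1}$ array of zeros and ones in which every line contains exactly one entry equal to $1$. An $[n]^{d+1}$ 0-1 array $M_1$ supports an $[n]^{d+1}$ array $M_2$ if $M_2(i_1,\dots,i_{d+1})=1$ implies $M_1(i_1,\dots,i_{d+1})=1$. The $d$-permanent $Per_d(A)$ of an $[n]^{d+1}$ 0-1 array $A$ is the number of $d$-dimensional permutations of order $n$ supported by $A$. *)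

theory Defs
  imports Complex_Main "HOL-Library.FuncSet"
begin

(* [n]^m; an index (i_1, ..., i_m) is a list, whose j-th coordinate is at list position j - 1. *)
definition indices :: "nat \<Rightarrow> nat \<Rightarrow> nat list set" where
  "indices n m = {is. length is = m \<and> set is \<subseteq> {1..n}}"

(* Extensional functions, so that two arrays are equal as soon as they agree on [n]^m; in
   particular there are only finitely many zero-one arrays and counting them with card is
   meaningful. *)
definition zero_one_arrays :: "nat \<Rightarrow> nat \<Rightarrow> (nat list \<Rightarrow> nat) set" where
  "zero_one_arrays n m = indices n m \<rightarrow>\<^sub>E {0, 1}"

(* xs and ys are the fixed coordinates before and after the varying one. *)
definition line :: "nat \<Rightarrow> (nat list \<Rightarrow> 'a) \<Rightarrow> nat list \<Rightarrow> nat list \<Rightarrow> 'a list" where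
  "line n P xs ys = map (\<lambda>t. P (xs @ [t] @ ys)) [1..<Suc n]"

definition lines :: "nat \<Rightarrow> nat \<Rightarrow> (nat list \<Rightarrow> 'a) \<Rightarrow> 'a list set" where
  "lines n m P =
    {line n P xs ys | xs ys. length xs + 1 + length ys = m \<and> set xs \<subseteq> {1..n} \<and> set ys \<subseteq> {1..n}}"

definition md_permutations :: "nat \<Rightarrow> nat \<Rightarrow> (nat list \<Rightarrow> nat) set" where
  "md_permutations d n =
    {P \<in> zero_one_arrays n (d + 1). \<forall>l \<in> lines n (d + 1) P. count_list l 1 = 1}"

definition supports :: "nat \<Rightarrow> nat \<Rightarrow> (nat list \<Rightarrow> nat) \<Rightarrow> (nat list \<Rightarrow> nat) \<Rightarrow> bool" where
  "supports d n M1 M2 \<longleftrightarrow> (\<forall>is \<in> indices n (d + 1). M2 is = 1 \<longrightarrow> M1 is = 1)"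

definition Per :: "nat \<Rightarrow> nat \<Rightarrow> (nat list \<Rightarrow> nat) \<Rightarrow> nat" where
  "Per d n A = card {P \<in> md_permutations d n. supports d n A P}"

(* Only the values at r \<ge> 1 are meaningful. *)
fun bound_exponent :: "nat \<Rightarrow> nat \<Rightarrow> real" where
  "bound_exponent 0 r = ln (real r)"
| "bound_exponent (Suc d) r = 1 / real r * (\<Sum>k = 1..r. bound_exponent d k)"

end

theory Submission
  imports Defs "HOL-Combinatorics.Permutations"
begin

text \<open>
  A permutation supported by A is a Latin function x on the positions p, with x p in the
  support of the line over p. Order each of the d axes at random and reveal the values of x in a
  compatible order of the positions. If N(x, p) values remain possible at p once its axis-parallel
  predecessors are known, then the sum over x of the product of the 1/N(x, p) is at most 1, so by
  Jensen's inequality log of the number of such x is at most the average over x of the sum over p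
  of log N(x, p). For fixed x and p the first axis order leaves a uniformly distributed number
  k of the r candidates, the second a uniformly distributed number of these k, and so on. This is
  the recursion of f, so f(d, r) is the mean of log N(x, p). This is the entropy argument of
  Radhakrishnan's proof of Bregman's theorem, with Kraft's inequality in place of the chain rule.
\<close>

section \<open>Kraft's inequality and the entropy bound it yields\<close>

text \<open>Positions with a larger key are revealed earlier, here and below.\<close>

lemma kraft_sum_le_1:
  fixes key :: "'i \<Rightarrow> 'k::linorder" and W :: "('i \<Rightarrow> 'v) \<Rightarrow> 'i \<Rightarrow> 'v set"
  assumes "finite I" "finite S"
    and "\<And>x y. x \<in> S \<Longrightarrow> y \<in> S \<Longrightarrow> (\<And>p. p \<in> I \<Longrightarrow> x p = y p) \<Longrightarrow> x = y"
    and "\<And>x p. x \<in> S \<Longrightarrow> p \<in> I \<Longrightarrow> finite (W x p)"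
    and "\<And>x p. x \<in> S \<Longrightarrow> p \<in> I \<Longrightarrow> x p \<in> W x p"
    and "\<And>x y p. x \<in> S \<Longrightarrow> y \<in> S \<Longrightarrow> p \<in> I
      \<Longrightarrow> (\<And>q. q \<in> I \<Longrightarrow> key q > key p \<Longrightarrow> x q = y q) \<Longrightarrow> W x p = W y p"
  shows "(\<Sum>x\<in>S. \<Prod>p\<in>I. 1 / real (card (W x p))) \<le> 1"
  using assms
\<comment> \<open>Positions are added in the order of \<open>key\<close>, so the last one added is
  revealed first. \<open>S\<close> stays arbitrary because the induction hypothesis is applied to
  the fibres of \<open>S\<close> with a prescribed value at that position.\<close>
proof (induction I arbitrary: S rule: finite_ranking_induct[where f = key])
  case empty
  then have "card S \<le> Suc 0"
    unfolding card_le_Suc0_iff_eq[OF empty.prems(1)] by blast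
  then show ?case by simp
next
  case (insert p J)
  show ?case
  proof (cases "S = {} \<or> p \<in> J")
    case True
    show ?thesis
    proof (cases "S = {}")
      case False
      with True have eq: "insert p J = J" by auto
      show ?thesis unfolding eq by (rule insert.IH[OF insert.prems[unfolded eq]])
    qed simp
  next
    case False
    then obtain x0 where x0: "x0 \<in> S" and p: "p \<notin> J" by auto
    define V where "V = W x0 p"
    \<comment> \<open>\<open>key p\<close> is maximal on \<open>insert p J\<close>: nothing is
      revealed before \<open>p\<close>, the agreement condition is vacuous, and all of
      \<open>S\<close> shares one candidate set at \<open>p\<close>.\<close>
    have WV: "W x p = V" if "x \<in> S" for x
      unfolding V_def
      by (rule insert.prems(5)) (use that x0 insert.hyps(2) in \<open>auto simp: not_le[symmetric]\<close>)
    have finV: "finite V" using insert.prems(3)[OF x0] V_def by simp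
    have xV: "x p \<in> V" if "x \<in> S" for x
      using insert.prems(4)[OF that, of p] WV[OF that] by simp
    have neV: "card V > 0" using xV[OF x0] finV card_gt_0_iff by blast
    have IH: "(\<Sum>x\<in>{x \<in> S. x p = v}. \<Prod>q\<in>J. 1 / real (card (W x q))) \<le> 1" for v
    proof (rule insert.IH)
      fix x y assume "x \<in> {x \<in> S. x p = v}" "y \<in> {x \<in> S. x p = v}" "\<And>q. q \<in> J \<Longrightarrow> x q = y q"
      then show "x = y" by (intro insert.prems(2)) auto
    next
      fix x y q assume "x \<in> {x \<in> S. x p = v}" "y \<in> {x \<in> S. x p = v}" "q \<in> J"
        "\<And>q'. q' \<in> J \<Longrightarrow> key q < key q' \<Longrightarrow> x q' = y q'"
      then show "W x q = W y q" by (intro insert.prems(5)) auto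
    qed (simp_all add: insert.prems(1,3,4))
    \<comment> \<open>The factor at \<open>p\<close> is the constant \<open>1 / card V\<close>.
      Grouping \<open>S\<close> by the value at \<open>p\<close> gives one group for each element of
      \<open>V\<close>, and by \<open>IH\<close> each contributes at most
      \<open>1 / card V\<close>.\<close>
    have "(\<Sum>x\<in>S. \<Prod>q\<in>insert p J. 1 / real (card (W x q)))
        = (\<Sum>x\<in>S. 1 / real (card V) * (\<Prod>q\<in>J. 1 / real (card (W x q))))"
      using insert.hyps(1) p WV by (intro sum.cong) auto
    also have "\<dots> = (\<Sum>v\<in>V. \<Sum>x\<in>{x \<in> S. x p = v}.
        1 / real (card V) * (\<Prod>q\<in>J. 1 / real (card (W x q))))"
      by (rule sum.group[symmetric]) (use insert.prems(1) finV xV in auto)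
    also have "\<dots> \<le> (\<Sum>v\<in>V. 1 / real (card V))"
    proof (rule sum_mono)
      fix v
      show "(\<Sum>x\<in>{x \<in> S. x p = v}. 1 / real (card V) * (\<Prod>q\<in>J. 1 / real (card (W x q))))
          \<le> 1 / real (card V)"
        unfolding sum_distrib_left[symmetric] by (rule mult_left_le[OF IH]) simp
    qed
    also have "\<dots> = 1" using neV by simp
    finally show ?thesis .
  qed
qed

text \<open>Jensen's inequality in tangent form: with \<open>c\<close> the size of \<open>S\<close>
  and \<open>w x\<close> the product of the reciprocal candidate counts,
  \<open>ln (c * w x) \<le> c * w x - 1\<close>. Summed over \<open>S\<close>, the right side is
  \<open>c\<close> times the Kraft sum minus \<open>c\<close>, hence at most 0.\<close>

lemma card_ln_card_le:
  fixes key :: "'i \<Rightarrow> 'k::linorder" and W :: "('i \<Rightarrow> 'v) \<Rightarrow> 'i \<Rightarrow> 'v set"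
  assumes "finite I" "finite S" "S \<noteq> {}"
    and "\<And>x y. x \<in> S \<Longrightarrow> y \<in> S \<Longrightarrow> (\<And>p. p \<in> I \<Longrightarrow> x p = y p) \<Longrightarrow> x = y"
    and fin: "\<And>x p. x \<in> S \<Longrightarrow> p \<in> I \<Longrightarrow> finite (W x p)"
    and mem: "\<And>x p. x \<in> S \<Longrightarrow> p \<in> I \<Longrightarrow> x p \<in> W x p"
    and "\<And>x y p. x \<in> S \<Longrightarrow> y \<in> S \<Longrightarrow> p \<in> I
      \<Longrightarrow> (\<And>q. q \<in> I \<Longrightarrow> key q > key p \<Longrightarrow> x q = y q) \<Longrightarrow> W x p = W y p"
  shows "real (card S) * ln (real (card S)) \<le> (\<Sum>x\<in>S. \<Sum>p\<in>I. ln (real (card (W x p))))"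
proof -
  define c where "c = real (card S)"
  define w where "w x = (\<Prod>p\<in>I. 1 / real (card (W x p)))" for x
  have c: "c > 0" using assms(2,3) by (simp add: c_def card_gt_0_iff)
  have W: "real (card (W x p)) > 0" if "x \<in> S" "p \<in> I" for x p
    using fin[OF that] mem[OF that] by (auto simp: card_gt_0_iff)
  have "ln c - (\<Sum>p\<in>I. ln (real (card (W x p)))) \<le> c * w x - 1" if x: "x \<in> S" for x
  proof -
    have "w x > 0" unfolding w_def by (rule prod_pos) (simp add: W[OF x] del: of_nat_0_less_iff)
    moreover have "ln (w x) = - (\<Sum>p\<in>I. ln (real (card (W x p))))"
    proof -
      have "ln (w x) = (\<Sum>p\<in>I. ln (1 / real (card (W x p))))"
        unfolding w_def by (rule ln_prod[OF assms(1)]) (rule less_imp_neq[OF divide_pos_pos[OF zero_less_one W[OF x]], symmetric])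
      also have "\<dots> = (\<Sum>p\<in>I. - ln (real (card (W x p))))"
        by (simp add: ln_inverse divide_inverse)
      finally show ?thesis by (simp add: sum_negf)
    qed
    ultimately show ?thesis
      using ln_le_minus_one[OF mult_pos_pos[OF c \<open>w x > 0\<close>]] ln_mult_pos[OF c \<open>w x > 0\<close>] by linarith
  qed
  then have "(\<Sum>x\<in>S. ln c - (\<Sum>p\<in>I. ln (real (card (W x p))))) \<le> (\<Sum>x\<in>S. c * w x - 1)"
    by (rule sum_mono)
  also have "\<dots> = c * (\<Sum>x\<in>S. w x) - c"
    by (simp add: sum_subtractf sum_distrib_left c_def)
  also have "\<dots> \<le> 0"
  proof -
    have "(\<Sum>x\<in>S. w x) \<le> 1"
      unfolding w_def by (rule kraft_sum_le_1[where key = key]) (fact assms)+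
    then have "c * (\<Sum>x\<in>S. w x) \<le> c" by (rule mult_left_le) (use c in simp)
    then show ?thesis by simp
  qed
  finally show ?thesis by (simp add: sum_subtractf c_def)
qed

section \<open>Random axis orders: ranks and surviving candidates\<close>

lemma bij_betw_rank:
  fixes \<sigma> :: "'a \<Rightarrow> 'b::linorder"
  assumes "finite T" "inj_on \<sigma> T"
  shows "bij_betw (\<lambda>i. card {t \<in> T. \<sigma> t \<le> \<sigma> i}) T {1..card T}"
proof -
  let ?c = "\<lambda>i. card {t \<in> T. \<sigma> t \<le> \<sigma> i}"
  have less: "?c i < ?c j" if "i \<in> T" "j \<in> T" "\<sigma> i < \<sigma> j" for i j
  proof (rule psubset_card_mono)
    have "{t \<in> T. \<sigma> t \<le> \<sigma> i} \<subseteq> {t \<in> T. \<sigma> t \<le> \<sigma> j}" using that(3) by auto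
    moreover have "j \<in> {t \<in> T. \<sigma> t \<le> \<sigma> j} - {t \<in> T. \<sigma> t \<le> \<sigma> i}" using that by auto
    ultimately show "{t \<in> T. \<sigma> t \<le> \<sigma> i} \<subset> {t \<in> T. \<sigma> t \<le> \<sigma> j}" by blast
  qed (use assms(1) in simp)
  have inj: "inj_on ?c T"
  proof (rule inj_onI)
    fix i j assume ij: "i \<in> T" "j \<in> T" "?c i = ?c j"
    then have "\<sigma> i = \<sigma> j"
      using less[of i j] less[of j i] by (cases "\<sigma> i" "\<sigma> j" rule: linorder_cases) simp_all
    then show "i = j" using ij assms(2) by (auto dest: inj_onD)
  qed
  have "?c i \<in> {1..card T}" if "i \<in> T" for i
  proof -
    have "?c i > 0" using that assms(1) by (subst card_gt_0_iff) auto
    moreover have "?c i \<le> card T" using assms(1) by (intro card_mono) auto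
    ultimately show ?thesis by simp
  qed
  then have "?c ` T = {1..card T}"
    using card_image[OF inj] by (intro card_subset_eq) auto
  with inj show ?thesis by (simp add: bij_betw_def)
qed

text \<open>By symmetry the sum is the same for every element of \<open>T\<close>, so it may be
  averaged over \<open>T\<close>; and for each single permutation the ranks within \<open>T\<close>
  run through \<open>{1..card T}\<close> once each. In other words, the rank of \<open>i\<close> is
  uniformly distributed.\<close>

lemma sum_permutations_rank:
  fixes g :: "nat \<Rightarrow> real" and U :: "'a::linorder set"
  assumes "finite U" "T \<subseteq> U" "i \<in> T"
  shows "(\<Sum>\<sigma> | \<sigma> permutes U. g (card {t \<in> T. \<sigma> t \<le> \<sigma> i}))
    = fact (card U) * (1 / real (card T) * (\<Sum>k = 1..card T. g k))"
proof -
  have finT: "finite T" using assms finite_subset by blast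
  define E where "E j = (\<Sum>\<sigma> | \<sigma> permutes U. g (card {t \<in> T. \<sigma> t \<le> \<sigma> j}))" for j
  have same: "E i = E j" if j: "j \<in> T" for j
  proof -
    let ?\<tau> = "transpose i j"
    have \<tau>: "?\<tau> permutes U" using assms j by (intro permutes_swap_id) auto
    have \<tau>T: "?\<tau> permutes T" using assms j by (intro permutes_swap_id) auto
    \<comment> \<open>The transposition preserves \<open>T\<close>, so composing with it merely
      relabels the counted set and exchanges the roles of \<open>i\<close> and
      \<open>j\<close>.\<close>
    have "card {t \<in> T. \<sigma> (?\<tau> t) \<le> \<sigma> (?\<tau> i)} = card {t \<in> T. \<sigma> t \<le> \<sigma> j}" for \<sigma> :: "'a \<Rightarrow> 'a"
    proof (rule bij_betw_same_card[where f = ?\<tau>])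
      show "bij_betw ?\<tau> {t \<in> T. \<sigma> (?\<tau> t) \<le> \<sigma> (?\<tau> i)} {t \<in> T. \<sigma> t \<le> \<sigma> j}"
        by (rule bij_betw_byWitness[where f' = ?\<tau>])
          (use permutes_in_image[OF \<tau>T] in auto)
    qed
    then show ?thesis
      unfolding E_def by (subst sum_permutations_compose_right[OF \<tau>]) (simp add: o_def)
  qed
  have "real (card T) * E i = (\<Sum>j\<in>T. E i)"
    by simp
  also have "\<dots> = (\<Sum>j\<in>T. E j)"
    by (rule sum.cong[OF refl same])
  also have "\<dots> = (\<Sum>\<sigma> | \<sigma> permutes U. \<Sum>j\<in>T. g (card {t \<in> T. \<sigma> t \<le> \<sigma> j}))"
    unfolding E_def by (rule sum.swap)
  also have "\<dots> = (\<Sum>\<sigma> | \<sigma> permutes U. \<Sum>k = 1..card T. g k)"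
  proof (rule sum.cong)
    fix \<sigma> assume "\<sigma> \<in> {\<sigma>. \<sigma> permutes U}"
    then have "inj_on \<sigma> T" by (auto intro: permutes_inj_on)
    then show "(\<Sum>j\<in>T. g (card {t \<in> T. \<sigma> t \<le> \<sigma> j})) = (\<Sum>k = 1..card T. g k)"
      by (rule sum.reindex_bij_betw[OF bij_betw_rank[OF finT]])
  qed simp
  also have "\<dots> = fact (card U) * (\<Sum>k = 1..card T. g k)"
    by (simp add: card_permutations[OF refl assms(1)])
  finally have "real (card T) * E i = fact (card U) * (\<Sum>k = 1..card T. g k)" .
  moreover have "card T > 0" using finT assms(3) card_gt_0_iff by blast
  ultimately show ?thesis by (simp add: E_def field_simps)
qed

lemma sum_lists_length_Suc:
  assumes "finite B"
  shows "(\<Sum>xs | set xs \<subseteq> B \<and> length xs = Suc d. h xs)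
    = (\<Sum>x\<in>B. \<Sum>xs | set xs \<subseteq> B \<and> length xs = d. h (x # xs))"
proof -
  have "(\<Sum>x\<in>B. \<Sum>xs | set xs \<subseteq> B \<and> length xs = d. h (x # xs))
    = (\<Sum>(x, xs)\<in>B \<times> {xs. set xs \<subseteq> B \<and> length xs = d}. h (x # xs))"
    by (rule sum.cartesian_product)
  also have "\<dots> = (\<Sum>xs | set xs \<subseteq> B \<and> length xs = Suc d. h xs)"
    by (rule sum.reindex_bij_witness[where i = "\<lambda>xs. (hd xs, tl xs)" and j = "\<lambda>(x, xs). x # xs"])
      (auto simp: length_Suc_conv)
  finally show ?thesis by simp
qed

text \<open>
  Here v is the true value at a position and pos s j is the place of the value j on the line through
  that position along axis s; j survives axis s unless it is revealed before v.
\<close>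

lemma sum_ln_card_surviving:
  fixes pos :: "nat \<Rightarrow> 'b \<Rightarrow> 'a::linorder"
  assumes "finite U" "finite R" "v \<in> R"
    and "\<And>s. s < d \<Longrightarrow> inj_on (pos s) R" "\<And>s. s < d \<Longrightarrow> pos s ` R \<subseteq> U"
  shows "(\<Sum>\<sigma> | set \<sigma> \<subseteq> {\<sigma>. \<sigma> permutes U} \<and> length \<sigma> = d.
      ln (real (card {j \<in> R. \<forall>s<d. (\<sigma> ! s) (pos s j) \<le> (\<sigma> ! s) (pos s v)})))
    = fact (card U) ^ d * bound_exponent d (card R)"
  using assms(2-)
proof (induction d arbitrary: R pos)
  case 0
  have "{\<sigma>. set \<sigma> \<subseteq> {\<sigma>. \<sigma> permutes U} \<and> length \<sigma> = 0} = {[]}" by auto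
  then show ?case by simp
next
  case (Suc d)
  let ?\<Omega> = "{\<sigma>. \<sigma> permutes U}"
  \<comment> \<open>The survivors of the first axis are the candidates for the other
    \<open>d\<close> axes; the induction hypothesis is applied to them with \<open>pos\<close>
    shifted by one.\<close>
  define R' where "R' \<tau> = {j \<in> R. \<tau> (pos 0 j) \<le> \<tau> (pos 0 v)}" for \<tau> :: "'a \<Rightarrow> 'a"
  have inj0: "inj_on (pos 0) R" and im0: "pos 0 ` R \<subseteq> U" using Suc.prems by auto
  have R': "finite (R' \<tau>)" "v \<in> R' \<tau>" "R' \<tau> \<subseteq> R" for \<tau>
    using Suc.prems(1,2) by (auto simp: R'_def)
  have step: "(\<Sum>\<sigma> | set \<sigma> \<subseteq> ?\<Omega> \<and> length \<sigma> = d.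
      ln (real (card {j \<in> R' \<tau>. \<forall>s<d. (\<sigma> ! s) (pos (Suc s) j) \<le> (\<sigma> ! s) (pos (Suc s) v)})))
    = fact (card U) ^ d * bound_exponent d (card (R' \<tau>))" for \<tau>
  proof (rule Suc.IH[OF R'(1,2)])
    fix s assume "s < d"
    then have "inj_on (pos (Suc s)) R" "pos (Suc s) ` R \<subseteq> U" using Suc.prems(3,4) by simp_all
    then show "inj_on (pos (Suc s)) (R' \<tau>)" "pos (Suc s) ` R' \<tau> \<subseteq> U"
      using R'(3)[of \<tau>] by (auto intro: inj_on_subset)
  qed
  have split: "{j \<in> R. \<forall>s<Suc d. ((\<tau> # \<sigma>) ! s) (pos s j) \<le> ((\<tau> # \<sigma>) ! s) (pos s v)}
      = {j \<in> R' \<tau>. \<forall>s<d. (\<sigma> ! s) (pos (Suc s) j) \<le> (\<sigma> ! s) (pos (Suc s) v)}" for \<tau> \<sigma>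
    by (auto simp: R'_def All_less_Suc2)
  \<comment> \<open>The number of survivors is the rank of \<open>pos 0 v\<close> within the image
    of \<open>R\<close>. Summing over the first axis order therefore averages
    \<open>bound_exponent d k\<close> over \<open>k\<close> from 1 to \<open>card R\<close>, which
    is the recursion of \<open>bound_exponent\<close>.\<close>
  have cardR': "card (R' \<tau>) = card {t \<in> pos 0 ` R. \<tau> t \<le> \<tau> (pos 0 v)}" for \<tau>
  proof -
    have "{t \<in> pos 0 ` R. \<tau> t \<le> \<tau> (pos 0 v)} = pos 0 ` R' \<tau>" by (auto simp: R'_def)
    then show ?thesis using card_image inj_on_subset[OF inj0 R'(3)] by metis
  qed
  have "(\<Sum>\<sigma> | set \<sigma> \<subseteq> ?\<Omega> \<and> length \<sigma> = Suc d.
      ln (real (card {j \<in> R. \<forall>s<Suc d. (\<sigma> ! s) (pos s j) \<le> (\<sigma> ! s) (pos s v)})))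
    = (\<Sum>\<tau>\<in>?\<Omega>. fact (card U) ^ d * bound_exponent d (card (R' \<tau>)))"
    by (subst sum_lists_length_Suc) (simp_all only: split step finite_permutations[OF assms(1)])
  also have "\<dots> = fact (card U) ^ d * (\<Sum>\<tau>\<in>?\<Omega>. bound_exponent d (card (R' \<tau>)))"
    by (simp add: sum_distrib_left)
  also have "(\<Sum>\<tau>\<in>?\<Omega>. bound_exponent d (card (R' \<tau>)))
      = fact (card U) * bound_exponent (Suc d) (card R)"
    unfolding cardR'
    by (subst sum_permutations_rank[OF assms(1) im0])
      (use Suc.prems(2) in \<open>simp_all add: card_image[OF inj0]\<close>)
  finally show ?case by simp
qed

section \<open>Counting Latin functions with prescribed candidate sets\<close>

lemma finite_indices: "finite (indices n m)"
  using finite_lists_length_eq[of "{1..n}" m] by (simp add: indices_def conj_commute)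

lemma indices_update: "p \<in> indices n m \<Longrightarrow> t \<in> {1..n} \<Longrightarrow> p[s := t] \<in> indices n m"
  using set_update_subset_insert[of p s t] by (auto simp: indices_def)

lemma indices_nth: "p \<in> indices n m \<Longrightarrow> s < m \<Longrightarrow> p ! s \<in> {1..n}"
  using nth_mem[of s p] unfolding indices_def by blast

text \<open>These are the Latin hypercubes of dimension \<open>d\<close>, Latin squares for
  \<open>d = 2\<close>. As \<open>t\<close> varies, \<open>p[s := t]\<close> runs through the line
  through \<open>p\<close> along axis \<open>s\<close>.\<close>

definition latin :: "nat \<Rightarrow> nat \<Rightarrow> (nat list \<Rightarrow> nat) set" where
  "latin n d = {x \<in> indices n d \<rightarrow>\<^sub>E {1..n}.
    \<forall>p\<in>indices n d. \<forall>s<d. inj_on (\<lambda>t. x (p[s := t])) {1..n}}"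

text \<open>Each tuple of axis orders gives an instance of \<open>card_ln_card_le\<close>. Averaging
  these over all tuples and exchanging the sums turns the logarithmic term at \<open>p\<close> into
  \<open>bound_exponent d (card (R p))\<close>, by \<open>sum_ln_card_surviving\<close>.\<close>

lemma ln_card_latin_le:
  fixes R :: "nat list \<Rightarrow> nat set"
  assumes R: "\<And>p. p \<in> indices n d \<Longrightarrow> R p \<subseteq> {1..n}"
    and L_def: "L = {x \<in> latin n d. \<forall>p\<in>indices n d. x p \<in> R p}" and "L \<noteq> {}"
  shows "ln (real (card L)) \<le> (\<Sum>p\<in>indices n d. bound_exponent d (card (R p)))"
proof -
  let ?I = "indices n d"
  define \<Omega> where "\<Omega> = {\<sigma>. set \<sigma> \<subseteq> {\<sigma>. \<sigma> permutes {1..n}} \<and> length \<sigma> = d}"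
  \<comment> \<open>A candidate is struck off when it occurs on an axis-parallel line through
    \<open>p\<close> at a place that the order of that axis reveals before \<open>p\<close>.\<close>
  define W where "W \<sigma> x p = {j \<in> R p. \<forall>s<d. \<forall>t\<in>{1..n}. x (p[s := t]) = j
    \<longrightarrow> (\<sigma> ! s) t \<le> (\<sigma> ! s) (p ! s)}" for \<sigma> :: "(nat \<Rightarrow> nat) list" and x :: "nat list \<Rightarrow> nat" and p
  have card\<Omega>: "real (card \<Omega>) = fact n ^ d"
    using card_lists_length_eq[OF finite_permutations, of "{1..n}" d]
    by (simp add: \<Omega>_def card_permutations)
  have finR: "finite (R p)" if "p \<in> ?I" for p
    using R[OF that] finite_subset by blast
  have LE: "x \<in> ?I \<rightarrow>\<^sub>E {1..n}" if "x \<in> L" for x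
    using that by (simp add: L_def latin_def)
  have finL: "finite L"
    by (rule finite_subset[of _ "?I \<rightarrow>\<^sub>E {1..n}"])
      (use LE in \<open>auto intro!: finite_PiE simp: finite_indices\<close>)
  have inj: "inj_on (\<lambda>t. x (p[s := t])) {1..n}" if "x \<in> L" "p \<in> ?I" "s < d" for x p s
    using that by (simp add: L_def latin_def)
  have W_avg: "(\<Sum>\<sigma>\<in>\<Omega>. ln (real (card (W \<sigma> x p)))) = fact n ^ d * bound_exponent d (card (R p))"
    if x: "x \<in> L" and p: "p \<in> ?I" for x p
  proof -
    \<comment> \<open>On each line \<open>x\<close> is a bijection of \<open>{1..n}\<close>; its
      inverse locates a value on the line, which brings \<open>W\<close> into the form of
      \<open>sum_ln_card_surviving\<close>.\<close>
    define pos where "pos s = the_inv_into {1..n} (\<lambda>t. x (p[s := t]))" for s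
    have bij: "bij_betw (\<lambda>t. x (p[s := t])) {1..n} {1..n}" if "s < d" for s
      unfolding bij_betw_def
    proof
      show "(\<lambda>t. x (p[s := t])) ` {1..n} = {1..n}"
        by (rule endo_inj_surj)
          (use inj[OF x p that] LE[OF x] indices_update[OF p] in \<open>auto simp: PiE_iff\<close>)
    qed (rule inj[OF x p that])
    have pos: "pos s t' = t \<longleftrightarrow> x (p[s := t]) = t'" if "s < d" "t \<in> {1..n}" "t' \<in> {1..n}" for s t t'
      unfolding pos_def using bij[OF that(1)] that(2,3)
      by (metis bij_betw_def f_the_inv_into_f the_inv_into_f_f)
    have bijpos: "bij_betw (pos s) {1..n} {1..n}" if "s < d" for s
      unfolding pos_def by (rule bij_betw_the_inv_into[OF bij[OF that]])
    have posin: "pos s j \<in> {1..n}" if "s < d" "j \<in> R p" for s j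
      using bijpos[OF that(1)] R[OF p] that(2) by (meson bij_betwE subsetD)
    have xp: "x p \<in> R p" using x p by (simp add: L_def)
    have posx: "pos s (x p) = p ! s" if "s < d" for s
      using pos[OF that indices_nth[OF p that], of "x p"] xp R[OF p] by auto
    have "W \<sigma> x p = {j \<in> R p. \<forall>s<d. (\<sigma> ! s) (pos s j) \<le> (\<sigma> ! s) (pos s (x p))}" for \<sigma>
    proof -
      have "(\<forall>t\<in>{1..n}. x (p[s := t]) = j \<longrightarrow> (\<sigma> ! s) t \<le> (\<sigma> ! s) (p ! s))
          \<longleftrightarrow> (\<sigma> ! s) (pos s j) \<le> (\<sigma> ! s) (pos s (x p))" if "j \<in> R p" "s < d" for j s
        using pos[OF that(2) _ subsetD[OF R[OF p] that(1)]] posin[OF that(2,1)] posx[OF that(2)]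
        by metis
      then show ?thesis unfolding W_def by blast
    qed
    moreover have "inj_on (pos s) (R p)" "pos s ` R p \<subseteq> {1..n}" if "s < d" for s
      using bijpos[OF that] R[OF p] posin[OF that] by (auto simp: bij_betw_def intro: inj_on_subset)
    ultimately show ?thesis
      using sum_ln_card_surviving[of "{1..n}" "R p" "x p" d pos, OF _ finR[OF p] xp]
      by (simp add: \<Omega>_def)
  qed
  have le: "real (card L) * ln (real (card L)) \<le> (\<Sum>x\<in>L. \<Sum>p\<in>?I. ln (real (card (W \<sigma> x p))))"
    if \<sigma>: "\<sigma> \<in> \<Omega>" for \<sigma>
  \<comment> \<open>Any key that is strictly increasing in each coordinate with respect to the axis orders would do.\<close>
  proof (rule card_ln_card_le[where key = "\<lambda>p. \<Sum>s<d. (\<sigma> ! s) (p ! s)"])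
    fix x y assume "x \<in> L" "y \<in> L" "\<And>p. p \<in> ?I \<Longrightarrow> x p = y p"
    then show "x = y" by (intro PiE_ext[OF LE LE])
  next
    fix x p assume "x \<in> L" "p \<in> ?I"
    then show "finite (W \<sigma> x p)" using finR by (simp add: W_def)
  next
    fix x p assume x: "x \<in> L" and p: "p \<in> ?I"
    \<comment> \<open>On each line through \<open>p\<close> the value \<open>x p\<close> occurs only
      at \<open>p\<close> itself, where the comparison is an equality, so the true value is never
      struck off.\<close>
    have "t = p ! s" if "s < d" "t \<in> {1..n}" "x (p[s := t]) = x p" for s t
      using inj_onD[OF inj[OF x p that(1)], of t "p ! s"] that indices_nth[OF p] by simp
    then show "x p \<in> W \<sigma> x p" using x p by (auto simp: W_def L_def)
  next
    fix x y p assume x: "x \<in> L" "y \<in> L" and p: "p \<in> ?I"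
      and agree: "\<And>q. q \<in> ?I \<Longrightarrow> (\<Sum>s<d. (\<sigma> ! s) (p ! s)) < (\<Sum>s<d. (\<sigma> ! s) (q ! s)) \<Longrightarrow> x q = y q"
    \<comment> \<open>Only coordinate \<open>s\<close> changes, and its summand in the key
      increases, so the new position is revealed before \<open>p\<close>.\<close>
    have "x (p[s := t]) = y (p[s := t])"
      if "s < d" "t \<in> {1..n}" "(\<sigma> ! s) (p ! s) < (\<sigma> ! s) t" for s t
    proof (rule agree)
      have "length p = d" using p by (simp add: indices_def)
      then show "(\<Sum>u<d. (\<sigma> ! u) (p ! u)) < (\<Sum>u<d. (\<sigma> ! u) (p[s := t] ! u))"
        by (intro sum_strict_mono_ex1) (use that in \<open>auto simp: nth_list_update\<close>)
    qed (rule indices_update[OF p that(2)])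
    \<comment> \<open>For the remaining \<open>t\<close> both implications have a true conclusion,
      whatever the values of \<open>x\<close> and \<open>y\<close>.\<close>
    then have "(x (p[s := t]) = j \<longrightarrow> (\<sigma> ! s) t \<le> (\<sigma> ! s) (p ! s))
        \<longleftrightarrow> (y (p[s := t]) = j \<longrightarrow> (\<sigma> ! s) t \<le> (\<sigma> ! s) (p ! s))"
      if "s < d" "t \<in> {1..n}" for s t j
      using that by (cases "(\<sigma> ! s) t \<le> (\<sigma> ! s) (p ! s)") simp_all
    then show "W \<sigma> x p = W \<sigma> y p"
      unfolding W_def by (intro Collect_cong conj_cong all_cong ball_cong refl)
  qed (use finite_indices finL assms(3) in auto)
  \<comment> \<open>The size \<open>fact n ^ d\<close> of \<open>\<Omega>\<close> reappears as the
    factor in \<open>W_avg\<close> and cancels, as does the positive \<open>card L\<close>.\<close>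
  have "fact n ^ d * (real (card L) * ln (real (card L)))
      = (\<Sum>\<sigma>\<in>\<Omega>. real (card L) * ln (real (card L)))"
    by (simp add: card\<Omega>)
  also have "\<dots> \<le> (\<Sum>\<sigma>\<in>\<Omega>. \<Sum>x\<in>L. \<Sum>p\<in>?I. ln (real (card (W \<sigma> x p))))"
    by (rule sum_mono[OF le])
  also have "\<dots> = (\<Sum>x\<in>L. \<Sum>p\<in>?I. \<Sum>\<sigma>\<in>\<Omega>. ln (real (card (W \<sigma> x p))))"
    by (subst sum.swap, rule sum.cong[OF refl], rule sum.swap)
  also have "\<dots> = fact n ^ d * (real (card L) * (\<Sum>p\<in>?I. bound_exponent d (card (R p))))"
    by (simp add: W_avg sum_distrib_left mult_ac)
  finally show ?thesis using finL assms(3) by (simp add: card_gt_0_iff)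
qed

section \<open>Multidimensional permutations as Latin functions\<close>

lemma count_list_line:
  "count_list (line n P xs ys) 1 = card {t \<in> {1..n}. P (xs @ [t] @ ys) = 1}"
proof -
  have "count_list (line n P xs ys) 1 = length (filter (\<lambda>t. P (xs @ [t] @ ys) = 1) [1..<Suc n])"
    by (simp add: line_def count_list_eq_length_filter filter_map o_def eq_commute[of "Suc 0"] del: upt_Suc)
  also have "\<dots> = card {t \<in> {1..n}. P (xs @ [t] @ ys) = 1}"
    by (subst distinct_length_filter) (auto intro: arg_cong[where f = card])
  finally show ?thesis .
qed

lemma md_permutation_ex1:
  assumes "P \<in> md_permutations d n" "length xs + length ys = d" "set xs \<subseteq> {1..n}" "set ys \<subseteq> {1..n}"
  shows "\<exists>!t. t \<in> {1..n} \<and> P (xs @ [t] @ ys) = 1"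
proof -
  have "line n P xs ys \<in> lines n (d + 1) P" using assms(2-) by (auto simp: lines_def)
  then have "card {t \<in> {1..n}. P (xs @ [t] @ ys) = 1} = 1"
    using assms(1) unfolding md_permutations_def count_list_line[symmetric] by blast
  then obtain t where "{t \<in> {1..n}. P (xs @ [t] @ ys) = 1} = {t}"
    by (auto simp only: card_1_singleton_iff One_nat_def)
  then have "t' \<in> {1..n} \<and> P (xs @ [t'] @ ys) = 1 \<longleftrightarrow> t' = t" for t'
    by (simp only: set_eq_iff mem_Collect_eq singleton_iff)
  then show ?thesis by simp
qed

text \<open>The last coordinate of a one is read as the symbol at the position given by the first
  \<open>d\<close>. The restriction makes the result extensional, as membership in
  \<open>latin\<close> requires.\<close>

definition symbol_function :: "nat \<Rightarrow> nat \<Rightarrow> (nat list \<Rightarrow> nat) \<Rightarrow> nat list \<Rightarrow> nat" where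
  "symbol_function d n P = restrict (\<lambda>p. THE t. t \<in> {1..n} \<and> P (p @ [t]) = 1) (indices n d)"

lemma symbol_function_eq_iff:
  assumes "P \<in> md_permutations d n" "p \<in> indices n d" "t \<in> {1..n}"
  shows "symbol_function d n P p = t \<longleftrightarrow> P (p @ [t]) = 1"
    and "symbol_function d n P p \<in> {1..n}"
proof -
  have ex1: "\<exists>!t. t \<in> {1..n} \<and> P (p @ [t]) = 1"
    using md_permutation_ex1[OF assms(1), of p "[]"] assms(2) by (simp add: indices_def)
  have "symbol_function d n P p = (THE t. t \<in> {1..n} \<and> P (p @ [t]) = 1)"
    using assms(2) by (simp add: symbol_function_def)
  then have *: "symbol_function d n P p \<in> {1..n} \<and> P (p @ [symbol_function d n P p]) = 1"
    using theI'[OF ex1] by simp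
  then show "symbol_function d n P p \<in> {1..n}" by simp
  show "symbol_function d n P p = t \<longleftrightarrow> P (p @ [t]) = 1"
    using * ex1 assms(3) by metis
qed

text \<open>If a symbol \<open>j\<close> occurred twice along axis \<open>s\<close>, the line of
  \<open>P\<close> in direction \<open>s\<close> with last coordinate \<open>j\<close> would contain
  two ones.\<close>

lemma symbol_function_latin:
  assumes "P \<in> md_permutations d n" "n \<ge> 1"
  shows "symbol_function d n P \<in> latin n d"
proof -
  let ?x = "symbol_function d n P"
  have val: "?x p \<in> {1..n}" if "p \<in> indices n d" for p
    using symbol_function_eq_iff(2)[OF assms(1) that, of 1] assms(2) by simp
  have "?x \<in> indices n d \<rightarrow>\<^sub>E {1..n}"
    using val by (simp add: PiE_iff symbol_function_def)
  moreover have "inj_on (\<lambda>t. ?x (p[s := t])) {1..n}" if p: "p \<in> indices n d" and s: "s < d" for p s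
  proof (rule inj_onI)
    fix t t' assume t: "t \<in> {1..n}" "t' \<in> {1..n}" and eq: "?x (p[s := t]) = ?x (p[s := t'])"
    define j where "j = ?x (p[s := t])"
    have len: "length p = d" using p by (simp add: indices_def)
    have j: "j \<in> {1..n}" using val indices_update[OF p t(1)] by (simp add: j_def)
    have one: "P (p[s := u] @ [j]) = 1" if "u \<in> {t, t'}" for u
      using symbol_function_eq_iff(1)[OF assms(1) indices_update[OF p, of u s] j] that t eq
      by (auto simp: j_def)
    have upd: "p[s := u] @ [j] = take s p @ [u] @ drop (Suc s) p @ [j]" for u
      using s len by (simp add: upd_conv_take_nth_drop)
    have "\<exists>!u. u \<in> {1..n} \<and> P (take s p @ [u] @ drop (Suc s) p @ [j]) = 1"
      using p s j len set_take_subset[of s p] set_drop_subset[of "Suc s" p]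
      by (intro md_permutation_ex1[OF assms(1)]) (auto simp: indices_def)
    then show "t = t'" using one[of t] one[of t'] t unfolding upd by auto
  qed
  ultimately show ?thesis by (simp add: latin_def)
qed

text \<open>The symbols determine the places of the ones, and all other entries are 0. Hence
  bounding the number of symbol functions bounds the permanent.\<close>

lemma inj_on_symbol_function: "inj_on (symbol_function d n) (md_permutations d n)"
proof (rule inj_onI)
  fix P Q assume P: "P \<in> md_permutations d n" and Q: "Q \<in> md_permutations d n"
    and eq: "symbol_function d n P = symbol_function d n Q"
  have PQ: "P \<in> indices n (d + 1) \<rightarrow>\<^sub>E {0, 1}" "Q \<in> indices n (d + 1) \<rightarrow>\<^sub>E {0, 1}"
    using P Q by (simp_all add: md_permutations_def zero_one_arrays_def)
  show "P = Q"
  proof (rule PiE_ext[OF PQ])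
    fix q assume q: "q \<in> indices n (d + 1)"
    then obtain p t where pt: "q = p @ [t]" "p \<in> indices n d" "t \<in> {1..n}"
      by (cases q rule: rev_cases) (auto simp: indices_def)
    then have "P q = 1 \<longleftrightarrow> Q q = 1"
      using symbol_function_eq_iff(1)[OF P pt(2,3)] symbol_function_eq_iff(1)[OF Q pt(2,3)] eq
      by simp
    moreover have "P q \<in> {0, 1}" "Q q \<in> {0, 1}" using PQ q by (auto simp: PiE_iff)
    ultimately show "P q = Q q" by auto
  qed
qed

theorem theorem1p6:
  fixes d n :: nat and A :: "nat list \<Rightarrow> nat" and r :: "nat list \<Rightarrow> nat"
  assumes "d \<ge> 1" and "n \<ge> 1"
    and "A \<in> zero_one_arrays n (d + 1)"
    and "\<And>is. is \<in> indices n d \<Longrightarrow> r is = count_list (line n A is []) 1"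
    and "\<And>is. is \<in> indices n d \<Longrightarrow> r is \<ge> 1"
  shows "real (Per d n A) \<le> (\<Prod>is \<in> indices n d. exp (bound_exponent d (r is)))"
proof -
  define R where "R p = {t \<in> {1..n}. A (p @ [t]) = 1}" for p
  define L where "L = {x \<in> latin n d. \<forall>p\<in>indices n d. x p \<in> R p}"
  have r: "r p = card (R p)" if "p \<in> indices n d" for p
    unfolding assms(4)[OF that] count_list_line by (simp add: R_def)
  have "L \<subseteq> indices n d \<rightarrow>\<^sub>E {1..n}" by (auto simp: L_def latin_def)
  then have finL: "finite L"
    by (rule finite_subset) (auto intro: finite_PiE simp: finite_indices)
  have "symbol_function d n P \<in> L" if P: "P \<in> md_permutations d n" and sup: "supports d n A P" for P
  proof -
    have "symbol_function d n P p \<in> R p" if p: "p \<in> indices n d" for p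
    proof -
      define t where "t = symbol_function d n P p"
      have t: "t \<in> {1..n}"
        using symbol_function_eq_iff(2)[OF P p, of 1] assms(2) by (simp add: t_def)
      then have "P (p @ [t]) = 1" using symbol_function_eq_iff(1)[OF P p t] t_def by simp
      moreover have "p @ [t] \<in> indices n (d + 1)" using p t by (simp add: indices_def)
      ultimately show ?thesis using sup t by (simp add: supports_def R_def t_def)
    qed
    then show ?thesis using symbol_function_latin[OF P assms(2)] by (simp add: L_def)
  qed
  then have "Per d n A \<le> card L"
    unfolding Per_def
    by (intro card_inj_on_le[where f = "symbol_function d n"] finL)
      (auto intro: inj_on_subset[OF inj_on_symbol_function])
  also have "real (card L) \<le> (\<Prod>p\<in>indices n d. exp (bound_exponent d (r p)))"
  \<comment> \<open>The logarithmic bound is for nonempty \<open>L\<close>; for empty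
    \<open>L\<close> the count is 0 and a product of exponentials is nonnegative.\<close>
  proof (cases "L = {}")
    case False
    then have "card L > 0" using finL by (simp add: card_gt_0_iff)
    then have "real (card L) = exp (ln (real (card L)))" by simp
    also have "\<dots> \<le> exp (\<Sum>p\<in>indices n d. bound_exponent d (card (R p)))"
      by (subst exp_le_cancel_iff, rule ln_card_latin_le[OF _ L_def False]) (auto simp: R_def)
    also have "\<dots> = (\<Prod>p\<in>indices n d. exp (bound_exponent d (r p)))"
      by (simp add: exp_sum finite_indices r)
    finally show ?thesis .
  qed (simp add: prod_nonneg)
  finally show ?thesis by simp
qed

end
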